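(* Let $\kappa$ be a strongly inaccessible cardinal. Then there are functions $\Phi_-:\mathcal{M}_\kappa\to\kappa^\kappa$ and $\Phi_+:\mathsf{pLoc}_\kappa\to\mathcal{M}_\kappa$ such that for all $A\in\mathcal{M}_\kappa$ and $\varphi\in\mathsf{pLoc}_\kappa$, if $\Phi_-(A)\in^*\varphi$ then $A\subseteq\Phi_+(\varphi)$. (That is, $(\kappa^\kappa,\mathsf{pLoc}_\kappa,\in^* )\preceq(\mathcal{M}_\kappa,\mathcal{M}_\kappa,\subseteq)$.)
   Context: $2^\kappa$ carries the topology generated by the sets $[s]=\{f\in2^\kappa:s\subseteq f\}$, $s\in2^{<\kappa}$; $\mathcal{M}_\kappa$ is the family of $\kappa$-meager subsets of $2^\kappa$, i.e. unions of at most $\kappa$ many nowhere dense sets. A partial slalom is a function $\varphi$ with $\mathrm{dom}(\varphi)\subseteq\kappa$, $|\mathrm{dom}(\varphi)|=\kappa$, and $\varphi(\alpha)\in[\kappa]^{|\alpha|}$ for $\alpha\in\mathrm{dom}(\varphi)$; $\mathsf{pLoc}_\kappa$ is the set of partial slaloms. For $f\in\kappa^\kappa$, $f\in^*\varphi$ means $|\{\alpha\in\mathrm{dom}(\varphi):f(\alpha)\notin\varphi(\alpha)\}|<\kappa$. *)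

theory Defs
  imports "HOL-Analysis.Analysis"
begin

unbundle cardinal_syntax

text \<open>
  A cardinal \<open>\<kappa>\<close> is a relation with \<^term>\<open>card_order \<kappa>\<close>, i.e. a well-order of minimal order type on
  all of the type \<open>'k\<close>. The elements of \<open>'k\<close> play the role of the ordinals below \<open>\<kappa>\<close>, and the
  ordinal \<open>\<alpha>\<close>, as the set of its predecessors, is \<^term>\<open>underS \<kappa> \<alpha>\<close>. Thus \<open>'k \<Rightarrow> bool\<close> is \<open>2\<^sup>\<kappa>\<close>
  and \<open>'k \<Rightarrow> 'k\<close> is \<open>\<kappa>\<^sup>\<kappa>\<close>.
\<close>

definition strongly_inaccessible :: "'k rel \<Rightarrow> bool" where
  "strongly_inaccessible \<kappa> \<longleftrightarrow>
     Card_order \<kappa> \<and> natLeq <o \<kappa> \<and> regularCard \<kappa> \<and>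
     (\<forall>A \<subseteq> Field \<kappa>. |A| <o \<kappa> \<longrightarrow> |Pow A| <o \<kappa>)"

definition seqs_below :: "'k rel \<Rightarrow> ('k \<rightharpoonup> bool) set" where
  "seqs_below \<kappa> = {s. \<exists>\<alpha>. dom s = underS \<kappa> \<alpha>}"

definition cone :: "('k \<rightharpoonup> bool) \<Rightarrow> ('k \<Rightarrow> bool) set" where
  "cone s = {f. s \<subseteq>\<^sub>m (Some \<circ> f)}"

definition cantor_topology :: "'k rel \<Rightarrow> ('k \<Rightarrow> bool) topology" where
  "cantor_topology \<kappa> = topology_generated_by (cone ` seqs_below \<kappa>)"

definition nowhere_dense_in :: "'a topology \<Rightarrow> 'a set \<Rightarrow> bool" where
  "nowhere_dense_in X N \<longleftrightarrow> N \<subseteq> topspace X \<and> X interior_of (X closure_of N) = {}"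

definition meager_sets :: "'k rel \<Rightarrow> ('k \<Rightarrow> bool) set set" where
  "meager_sets \<kappa> =
     {\<Union>\<N> | \<N>. |\<N>| \<le>o \<kappa> \<and> (\<forall>N\<in>\<N>. nowhere_dense_in (cantor_topology \<kappa>) N)}"

text \<open>As \<open>[\<kappa>]\<^sup>\<lambda>\<close> is the family of subsets of size exactly \<open>\<lambda>\<close>, the values of a slalom have size
  exactly \<open>|\<alpha>|\<close>.\<close>

definition partial_slaloms :: "'k rel \<Rightarrow> ('k \<rightharpoonup> 'k set) set" where
  "partial_slaloms \<kappa> =
     {\<phi>. |dom \<phi>| =o \<kappa> \<and> (\<forall>\<alpha>\<in>dom \<phi>. |the (\<phi> \<alpha>)| =o |underS \<kappa> \<alpha>| )}"

definition localized_by :: "'k rel \<Rightarrow> ('k \<Rightarrow> 'k) \<Rightarrow> ('k \<rightharpoonup> 'k set) \<Rightarrow> bool" where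
  "localized_by \<kappa> f \<phi> \<longleftrightarrow> |{\<alpha>\<in>dom \<phi>. f \<alpha> \<notin> the (\<phi> \<alpha>)}| <o \<kappa>"

end

theory Submission
  imports Defs
begin

text \<open>
  Let \<open>A = \<Union>i<\<kappa>. N i\<close> with \<open>N i\<close> nowhere dense. Unions of fewer than \<open>\<kappa>\<close> nowhere dense sets are
  nowhere dense, so for infinite \<open>\<alpha>\<close> a closing-off argument yields \<open>h > \<alpha>\<close> of cofinality greater
  than \<open>|\<alpha>|\<close> such that every sequence of length below \<open>h\<close> has an extension of length below \<open>h\<close>
  whose cone misses \<open>\<Union>i<\<alpha>. N i\<close>. The set \<open>U\<close> of sequences of length \<open>h\<close> with an initial segment
  of this kind is coded, together with \<open>h\<close>, by the ordinal \<open>\<Phi>m A \<alpha>\<close>.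

  Any \<open>|\<alpha>|\<close> many such codes \<open>(h, U)\<close> can be met by extensions of a single sequence of length
  \<open>\<alpha>\<close>: treat them in increasing order of \<open>h\<close>, so that at each step the current length is a
  supremum of at most \<open>|\<alpha>|\<close> ordinals below the \<open>h\<close> in question, and hence itself below \<open>h\<close>.
  Therefore the points that, for all \<open>\<alpha> \<in> dom \<phi>\<close> above some bound, miss at least one code in
  \<open>\<phi> \<alpha>\<close> form a meager set \<open>\<Phi>p \<phi>\<close>.
\<close>

section \<open>The well-order of \<open>\<kappa>\<close> and its cardinal arithmetic\<close>

locale inaccessible_cardinal =
  fixes \<kappa> :: "'k rel"
  assumes card_order: "card_order \<kappa>" and inaccessible: "strongly_inaccessible \<kappa>"
begin

definition le :: "'k \<Rightarrow> 'k \<Rightarrow> bool" (infix "\<sqsubseteq>" 50) where "a \<sqsubseteq> b \<longleftrightarrow> (a, b) \<in> \<kappa>"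

definition lt :: "'k \<Rightarrow> 'k \<Rightarrow> bool" (infix "\<sqsubset>" 50) where "a \<sqsubset> b \<longleftrightarrow> a \<noteq> b \<and> (a, b) \<in> \<kappa>"

lemma Card_order: "Card_order \<kappa>" and Field_eq: "Field \<kappa> = UNIV"
  using card_order card_order_on_Card_order by auto

lemma Well_order: "well_order_on UNIV \<kappa>"
  using card_order by (simp add: card_order_on_def)

sublocale K: wellorder le lt
proof -
  have lin: "linear_order_on UNIV \<kappa>" and wf: "wf (\<kappa> - Id)"
    using Well_order by (auto simp: well_order_on_def)
  then have refl: "(a, a) \<in> \<kappa>" and trans: "(a, b) \<in> \<kappa> \<Longrightarrow> (b, c) \<in> \<kappa> \<Longrightarrow> (a, c) \<in> \<kappa>"
    and antisym: "(a, b) \<in> \<kappa> \<Longrightarrow> (b, a) \<in> \<kappa> \<Longrightarrow> a = b" for a b c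
    unfolding linear_order_on_def partial_order_on_def preorder_on_def refl_on_def
    by (auto dest: transD antisymD)
  have total: "(a, b) \<in> \<kappa> \<or> (b, a) \<in> \<kappa>" for a b
    using lin refl by (cases "a = b") (auto simp: linear_order_on_def total_on_def)
  show "class.wellorder le lt"
  proof (unfold_locales, unfold le_def lt_def)
    fix P and a :: 'k
    assume "\<And>x. (\<And>y. y \<noteq> x \<and> (y, x) \<in> \<kappa> \<Longrightarrow> P y) \<Longrightarrow> P x"
    then show "P a"
      using wf_induct[OF wf, of P a] by blast
  qed (use refl trans antisym total in blast)+
qed

lemma wf_lt: "wf {(a, b). a \<sqsubset> b}"
proof -
  have "{(a, b). a \<sqsubset> b} = \<kappa> - Id"
    by (auto simp: lt_def)
  then show ?thesis
    using Well_order by (simp add: well_order_on_def)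
qed

lemma mem_underS [simp]: "a \<in> underS \<kappa> b \<longleftrightarrow> a \<sqsubset> b"
  by (auto simp: underS_def lt_def)

lemma card_UNIV: "|UNIV :: 'k set| =o \<kappa>"
  using card_of_Field_ordIso[OF Card_order] by (simp add: Field_eq)

lemma infinite_UNIV: "infinite (UNIV :: 'k set)"
proof -
  have "natLeq \<le>o \<kappa>"
    using inaccessible by (simp add: strongly_inaccessible_def ordLess_imp_ordLeq)
  then have "|UNIV :: nat set| \<le>o |UNIV :: 'k set|"
    using card_UNIV card_of_nat by (meson ordIso_symmetric ordIso_ordLeq_trans ordLeq_ordIso_trans)
  then show ?thesis
    by (simp add: infinite_iff_card_of_nat)
qed

lemma ex_gt: "\<exists>b. a \<sqsubset> b"
  using infinite_Card_order_limit[OF Card_order, of a] infinite_UNIV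
  by (auto simp: Field_eq lt_def)

lemma ex_upper: "\<exists>c. a \<sqsubseteq> c \<and> b \<sqsubseteq> c"
  using K.linear by blast

text \<open>By regularity \<open>X\<close> is not cofinal; the bound becomes strict because there is
  no greatest element.\<close>

lemma small_bounded:
  assumes "|X| <o \<kappa>"
  obtains b where "\<And>a. a \<in> X \<Longrightarrow> a \<sqsubset> b"
proof -
  have "\<not> cofinal X \<kappa>"
    using inaccessible assms not_ordLess_ordIso
    by (auto simp: strongly_inaccessible_def regularCard_def Field_eq)
  then obtain b where b: "\<And>a. a \<in> X \<Longrightarrow> \<not> b \<sqsubset> a"
    by (auto simp: cofinal_def lt_def)
  obtain c where "b \<sqsubset> c"
    using ex_gt by blast
  then have "a \<sqsubset> c" if "a \<in> X" for a
    using b[OF that] K.le_less_trans K.not_less by blast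
  then show ?thesis
    using that by blast
qed

lemma card_underS: "|underS \<kappa> a| <o \<kappa>"
  using card_of_underS[OF Card_order] by (simp add: Field_eq)

lemma unbounded:
  assumes "|X| =o \<kappa>"
  shows "\<exists>a\<in>X. b \<sqsubseteq> a"
proof (rule ccontr)
  assume "\<not> ?thesis"
  then have "X \<subseteq> underS \<kappa> b"
    by auto
  then have "|X| <o \<kappa>"
    using card_of_mono1 card_underS ordLeq_ordLess_trans by blast
  then show False
    using assms not_ordLess_ordIso by blast
qed

text \<open>The strong limit hypothesis speaks only of subsets of \<open>'k\<close>. Passing to a
  copy inside \<open>'k\<close> makes it available for sets over any type, so that
  \<open>card_Pow\<close> can be iterated.\<close>

lemma embed_small:
  fixes A :: "'b set"
  assumes "|A| <o \<kappa>"
  obtains B :: "'k set" where "|A| =o |B|"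
proof -
  have "|A| \<le>o |UNIV :: 'k set|"
    using assms card_UNIV by (meson ordIso_symmetric ordLess_imp_ordLeq ordLess_ordIso_trans)
  then show ?thesis
    using that internalize_card_of_ordLeq[of A "|UNIV :: 'k set|"] internalize_card_of_ordLeq2
    by metis
qed

lemma card_Pow:
  fixes A :: "'b set"
  assumes "|A| <o \<kappa>"
  shows "|Pow A| <o \<kappa>"
proof -
  obtain B :: "'k set" where B: "|A| =o |B|"
    using embed_small[OF assms] .
  then obtain f where "bij_betw f A B"
    using card_of_ordIso by blast
  then have "bij_betw ((`) f) (Pow A) (Pow B)"
    by (rule bij_betw_Pow)
  then have "|Pow A| =o |Pow B|"
    using card_of_ordIso by blast
  moreover have "|B| <o \<kappa>"
    using B assms ordIso_ordLess_trans ordIso_symmetric by blast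
  then have "|Pow B| <o \<kappa>"
    using inaccessible by (simp add: strongly_inaccessible_def Field_eq)
  ultimately show ?thesis
    by (rule ordIso_ordLess_trans)
qed

subsection \<open>Cylinders and nowhere dense sets\<close>

text \<open>This is the cone of the sequence of length \<open>a\<close> obtained by restricting
  \<open>x\<close>. Total functions represent sequences here, and the values of \<open>x\<close>
  from \<open>a\<close> on are irrelevant.\<close>

definition cyl :: "('k \<Rightarrow> bool) \<Rightarrow> 'k \<Rightarrow> ('k \<Rightarrow> bool) set" where
  "cyl x a = {y. \<forall>i. i \<sqsubset> a \<longrightarrow> y i = x i}"

lemma cyl_refl [simp]: "x \<in> cyl x a"
  by (simp add: cyl_def)

lemma cyl_trans: "z \<in> cyl y b \<Longrightarrow> y \<in> cyl x a \<Longrightarrow> a \<sqsubseteq> b \<Longrightarrow> z \<in> cyl x a"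
  unfolding cyl_def using K.less_le_trans by fastforce

lemma cyl_mono: "a \<sqsubseteq> b \<Longrightarrow> cyl x b \<subseteq> cyl x a"
  using cyl_trans[OF _ cyl_refl] by blast

lemma cyl_subset: "y \<in> cyl x a \<Longrightarrow> a \<sqsubseteq> b \<Longrightarrow> cyl y b \<subseteq> cyl x a"
  using cyl_trans by blast

lemma range_cone: "cone ` seqs_below \<kappa> = {cyl x a | x a. True}"
proof (intro set_eqI iffI)
  fix S
  assume "S \<in> cone ` seqs_below \<kappa>"
  then obtain s a where s: "S = cone s" "dom s = underS \<kappa> a"
    by (auto simp: seqs_below_def)
  have "cone s = cyl (\<lambda>i. the (s i)) a"
  proof (intro set_eqI)
    fix f
    have "s i = Some (f i) \<longleftrightarrow> f i = the (s i)" if "i \<in> dom s" for i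
      using that by auto
    then have "s \<subseteq>\<^sub>m (Some \<circ> f) \<longleftrightarrow> (\<forall>i\<in>dom s. f i = the (s i))"
      by (simp add: map_le_def)
    then show "f \<in> cone s \<longleftrightarrow> f \<in> cyl (\<lambda>i. the (s i)) a"
      by (simp add: cone_def cyl_def s(2) Ball_def)
  qed
  then show "S \<in> {cyl x a | x a. True}"
    using s by blast
next
  fix S
  assume "S \<in> {cyl x a | x a. True}"
  then obtain x a where S: "S = cyl x a"
    by blast
  define s where "s = (\<lambda>i. if i \<sqsubset> a then Some (x i) else None)"
  have d: "dom s = underS \<kappa> a"
    by (auto simp: s_def split: if_splits)
  then have "s \<in> seqs_below \<kappa>"
    by (auto simp: seqs_below_def)
  moreover have "cone s = S"
    unfolding S cone_def cyl_def map_le_def d by (auto simp: s_def)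
  ultimately show "S \<in> cone ` seqs_below \<kappa>"
    by blast
qed

lemma openin_cyl: "openin (cantor_topology \<kappa>) (cyl x a)"
  unfolding cantor_topology_def range_cone by (rule topology_generated_by_Basis) blast

lemma topspace_cantor: "topspace (cantor_topology \<kappa>) = UNIV"
proof -
  have "x \<in> topspace (cantor_topology \<kappa>)" for x
    using openin_subset[OF openin_cyl[of x undefined]] cyl_refl by blast
  then show ?thesis
    by blast
qed

lemma openin_contains_cyl:
  assumes "openin (cantor_topology \<kappa>) W" "x \<in> W"
  shows "\<exists>a. cyl x a \<subseteq> W"
proof -
  have "generate_topology_on {cyl x a | x a. True} W"
    using assms(1) unfolding cantor_topology_def range_cone
    by (rule openin_topology_generated_by)
  then show ?thesis
    using assms(2)
  proof (induction arbitrary: x)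
    case (Int V W)
    then obtain a b where "cyl x a \<subseteq> V" "cyl x b \<subseteq> W"
      by blast
    moreover obtain c where "a \<sqsubseteq> c" "b \<sqsubseteq> c"
      using ex_upper by blast
    ultimately show ?case
      using cyl_mono by blast
  next
    case (UN K)
    then show ?case
      by blast
  next
    case (Basis S)
    then obtain y a where S: "S = cyl y a"
      by blast
    then have "cyl x a \<subseteq> S"
      using Basis cyl_subset by blast
    then show ?case ..
  qed blast
qed

text \<open>Combinatorial nowhere density: every sequence extends to one whose cone misses
  \<open>N\<close>. The condition \<open>a \<sqsubseteq> b\<close> makes the new cone a subset of
  the old one.\<close>

definition nwd :: "('k \<Rightarrow> bool) set \<Rightarrow> bool" where
  "nwd N \<longleftrightarrow> (\<forall>x a. \<exists>y\<in>cyl x a. \<exists>b. a \<sqsubseteq> b \<and> cyl y b \<inter> N = {})"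

lemma nowhere_dense_iff: "nowhere_dense_in (cantor_topology \<kappa>) N \<longleftrightarrow> nwd N"
proof
  assume N: "nowhere_dense_in (cantor_topology \<kappa>) N"
  show "nwd N"
    unfolding nwd_def
  proof (intro allI)
    fix x a
    have "\<not> cyl x a \<subseteq> cantor_topology \<kappa> closure_of N"
      using N interior_of_maximal[OF _ openin_cyl[of x a]] cyl_refl[of x a]
      unfolding nowhere_dense_in_def by blast
    then obtain y where y: "y \<in> cyl x a" "y \<notin> cantor_topology \<kappa> closure_of N"
      by blast
    then obtain W where W: "openin (cantor_topology \<kappa>) W" "y \<in> W" "W \<inter> N = {}"
      unfolding in_closure_of topspace_cantor by blast
    then obtain b where "cyl y b \<subseteq> W"
      using openin_contains_cyl by blast
    moreover obtain c where "a \<sqsubseteq> c" "b \<sqsubseteq> c"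
      using ex_upper by blast
    ultimately show "\<exists>y\<in>cyl x a. \<exists>b. a \<sqsubseteq> b \<and> cyl y b \<inter> N = {}"
      using y(1) W(3) cyl_mono[of b c y] by blast
  qed
next
  assume N: "nwd N"
  have False if x: "x \<in> cantor_topology \<kappa> interior_of (cantor_topology \<kappa> closure_of N)" for x
  proof -
    obtain W where W: "openin (cantor_topology \<kappa>) W" "x \<in> W" "W \<subseteq> cantor_topology \<kappa> closure_of N"
      using x by (auto simp: interior_of_def)
    then obtain a where a: "cyl x a \<subseteq> W"
      using openin_contains_cyl by blast
    obtain y b where y: "y \<in> cyl x a" "cyl y b \<inter> N = {}"
      using N by (force simp: nwd_def)
    then have "y \<in> cantor_topology \<kappa> closure_of N"
      using a W by blast
    then show False
      using y(2) openin_cyl[of y b] cyl_refl[of y b] unfolding in_closure_of by blast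
  qed
  then show "nowhere_dense_in (cantor_topology \<kappa>) N"
    by (auto simp: nowhere_dense_in_def topspace_cantor)
qed

section \<open>Extending one sequence into many dense sets\<close>

lemma amalgamate:
  assumes "\<And>y a z b. (y, a) \<in> T \<Longrightarrow> (z, b) \<in> T \<Longrightarrow> y \<in> cyl z b \<or> z \<in> cyl y a"
  obtains w where "\<And>y a. (y, a) \<in> T \<Longrightarrow> w \<in> cyl y a"
proof
  \<comment> \<open>This is the union of the sequences coded by \<open>T\<close>: any two agree
    where both are defined, and positions beyond all lengths get the value False.\<close>
  define w where "w i = (\<exists>(y, a)\<in>T. i \<sqsubset> a \<and> y i)" for i
  fix y a
  assume "(y, a) \<in> T"
  then have "w i = y i" if "i \<sqsubset> a" for i
    using assms[OF \<open>(y, a) \<in> T\<close>] that by (fastforce simp: w_def cyl_def)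
  then show "w \<in> cyl y a"
    by (simp add: cyl_def)
qed

lemma extend_into_all:
  fixes C :: "'c set" and H :: "'c \<Rightarrow> 'k set"
  assumes wf: "wf R" and total: "total_on C R" and small: "|C| <o \<kappa>"
    and mono: "\<And>c d. c \<in> C \<Longrightarrow> d \<in> C \<Longrightarrow> (c, d) \<in> R \<Longrightarrow> H c \<subseteq> H d"
    and bounded: "\<And>c X. c \<in> C \<Longrightarrow> X \<subseteq> H c \<Longrightarrow> |X| \<le>o |C| \<Longrightarrow> \<exists>b\<in>H c. \<forall>a\<in>X. a \<sqsubseteq> b"
    and dense: "\<And>c x b. c \<in> C \<Longrightarrow> b \<in> H c \<Longrightarrow> \<exists>y\<in>cyl x b. \<exists>g\<in>H c. b \<sqsubseteq> g \<and> cyl y g \<subseteq> Q c"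
    and start: "\<And>c. c \<in> C \<Longrightarrow> a \<in> H c"
  shows "\<exists>y\<in>cyl x a. \<exists>g. a \<sqsubseteq> g \<and> cyl y g \<subseteq> (\<Inter>c\<in>C. Q c)"
proof -
  define S where "S = R \<inter> C \<times> C"
  have wfS: "wf S"
    using wf by (rule wf_subset) (simp add: S_def)
  \<comment> \<open>\<open>p\<close> is the sequence chosen at stage \<open>c\<close> together with
    its length. The last clause makes it extend all earlier choices, so the choices form a chain;
    the guard \<open>c \<in> C\<close> makes the recursion total on the type.\<close>
  define P where "P f c p \<longleftrightarrow> (c \<in> C \<longrightarrow>
      snd p \<in> H c \<and> cyl (fst p) (snd p) \<subseteq> Q c \<and> fst p \<in> cyl x a \<and>
      (\<forall>d. (d, c) \<in> S \<longrightarrow> fst p \<in> cyl (fst (f d)) (snd (f d))))"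
    for f :: "'c \<Rightarrow> ('k \<Rightarrow> bool) \<times> 'k" and c p
  have chain: "fst (f c) \<in> cyl (fst (f d)) (snd (f d)) \<or> fst (f d) \<in> cyl (fst (f c)) (snd (f c))"
    if "c \<in> C" "d \<in> C" "P f c (f c)" "P f d (f d)" for f c d
  proof (cases "c = d")
    case False
    then have "(c, d) \<in> S \<or> (d, c) \<in> S"
      using total that by (auto simp: S_def total_on_def)
    then show ?thesis
      using that unfolding P_def by blast
  qed simp
  have common: "\<exists>w\<in>cyl x a. \<forall>d\<in>D. w \<in> cyl (fst (f d)) (snd (f d))"
    if "D \<subseteq> C" "\<And>d. d \<in> D \<Longrightarrow> P f d (f d)" for D f
  proof -
    \<comment> \<open>Including \<open>(x, a)\<close> makes the amalgam extend the starting
      sequence, even when \<open>D\<close> is empty.\<close>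
    let ?T = "insert (x, a) (f ` D)"
    have *: "fst (f d) \<in> cyl x a" if "d \<in> D" for d
      using \<open>D \<subseteq> C\<close> \<open>d \<in> D \<Longrightarrow> P f d (f d)\<close> that by (auto simp: P_def)
    have "fst p \<in> cyl (fst q) (snd q) \<or> fst q \<in> cyl (fst p) (snd p)" if "p \<in> ?T" "q \<in> ?T" for p q
      using that
    proof (elim insertE imageE)
      fix c d
      assume "p = f c" "c \<in> D" "q = f d" "d \<in> D"
      then show ?thesis
        using chain[of c d f] \<open>D \<subseteq> C\<close> \<open>\<And>d. d \<in> D \<Longrightarrow> P f d (f d)\<close> by blast
    qed (use * in auto)
    then obtain w where w: "\<And>y b. (y, b) \<in> ?T \<Longrightarrow> w \<in> cyl y b"
      using amalgamate[of ?T] by (metis fst_conv snd_conv)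
    have "w \<in> cyl (fst (f d)) (snd (f d))" if "d \<in> D" for d
      using that by (intro w) auto
    then show ?thesis
      using w by blast
  qed
  have "\<exists>f. \<forall>c. P f c (f c)"
  proof (rule dependent_wf_choice[OF wfS])
    fix f g :: "'c \<Rightarrow> ('k \<Rightarrow> bool) \<times> 'k" and c p
    assume "\<And>z. (z, c) \<in> S \<Longrightarrow> f z = g z"
    then show "P f c p = P g c p"
      by (auto simp: P_def)
  next
    fix c f
    assume f: "\<And>d. (d, c) \<in> S \<Longrightarrow> P f d (f d)"
    show "\<exists>p. P f c p"
    proof (cases "c \<in> C")
      case True
      define D where "D = {d. (d, c) \<in> S}"
      have DC: "D \<subseteq> C"
        by (auto simp: D_def S_def)
      have PD: "P f d (f d)" if "d \<in> D" for d
        using f that by (simp add: D_def)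
      obtain w where w: "w \<in> cyl x a" "\<And>d. d \<in> D \<Longrightarrow> w \<in> cyl (fst (f d)) (snd (f d))"
        using common[OF DC PD] by blast
      have "snd (f d) \<in> H c" if "d \<in> D" for d
      proof -
        have d: "d \<in> C" "(d, c) \<in> R"
          using that by (auto simp: D_def S_def)
        then have "snd (f d) \<in> H d"
          using PD[OF that] by (simp add: P_def)
        then show ?thesis
          using mono[OF d(1) True d(2)] by blast
      qed
      then have "(snd \<circ> f) ` D \<subseteq> H c"
        by auto
      moreover have "|(snd \<circ> f) ` D| \<le>o |C|"
        using card_of_image card_of_mono1[OF DC] ordLeq_transitive by blast
      ultimately obtain b0 where "b0 \<in> H c" "\<forall>e\<in>(snd \<circ> f) ` D. e \<sqsubseteq> b0"
        using bounded[OF True] by blast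
      then have b0: "b0 \<in> H c" "\<And>d. d \<in> D \<Longrightarrow> snd (f d) \<sqsubseteq> b0"
        by auto
      obtain b where b: "b \<in> H c" "a \<sqsubseteq> b" "b0 \<sqsubseteq> b"
        using b0(1) start[OF True] K.linear[of a b0] by blast
      obtain y g where y: "y \<in> cyl w b" "g \<in> H c" "b \<sqsubseteq> g" "cyl y g \<subseteq> Q c"
        using dense[OF True b(1)] by blast
      have "y \<in> cyl x a"
        using cyl_trans[OF y(1) _ b(2)] w by blast
      moreover have "y \<in> cyl (fst (f d)) (snd (f d))" if "(d, c) \<in> S" for d
      proof (rule cyl_trans[OF y(1)])
        have "d \<in> D"
          using that by (simp add: D_def)
        then show "w \<in> cyl (fst (f d)) (snd (f d))" "snd (f d) \<sqsubseteq> b"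
          using w b0 b(3) K.order_trans by blast+
      qed
      ultimately have "P f c (y, g)"
        using y by (simp add: P_def)
      then show ?thesis ..
    qed (simp add: P_def)
  qed
  then obtain f where f: "\<And>c. P f c (f c)"
    by blast
  obtain w where w: "w \<in> cyl x a" "\<And>d. d \<in> C \<Longrightarrow> w \<in> cyl (fst (f d)) (snd (f d))"
    using common[of C f] f by blast
  \<comment> \<open>The final length need not lie in any \<open>H c\<close>; regularity of
    \<open>\<kappa>\<close> alone bounds it.\<close>
  have "|(snd \<circ> f) ` C| <o \<kappa>"
    using card_of_image small ordLeq_ordLess_trans by blast
  then obtain b0 where b0: "\<And>d. d \<in> C \<Longrightarrow> snd (f d) \<sqsubset> b0"
    using small_bounded by (metis (no_types, lifting) comp_apply imageI)
  obtain b where b: "a \<sqsubseteq> b" "b0 \<sqsubseteq> b"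
    using ex_upper by blast
  have "cyl w b \<subseteq> Q c" if "c \<in> C" for c
  proof -
    have "w \<in> cyl (fst (f c)) (snd (f c))"
      using w that by blast
    moreover have "snd (f c) \<sqsubseteq> b"
      using b0[OF that] b K.less_imp_le K.order_trans by blast
    ultimately show ?thesis
      using f[of c] that cyl_subset by (fastforce simp: P_def)
  qed
  then show ?thesis
    using w b by blast
qed

lemma nwd_UNION:
  assumes small: "|I| <o \<kappa>" and N: "\<And>i. i \<in> I \<Longrightarrow> nwd (N i)"
  shows "nwd (\<Union>i\<in>I. N (i :: 'k))"
  unfolding nwd_def
proof (intro allI)
  fix x a
  have "\<exists>y\<in>cyl x a. \<exists>b. a \<sqsubseteq> b \<and> cyl y b \<subseteq> (\<Inter>i\<in>I. - N i)"
  proof (rule extend_into_all[OF wf_lt _ small, where H = "\<lambda>_. UNIV"])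
    show "total_on I {(a, b). a \<sqsubset> b}"
      by (auto simp: total_on_def)
    show "\<exists>b\<in>UNIV. \<forall>a\<in>X. a \<sqsubseteq> b" if X: "|X| \<le>o |I|" for X
    proof -
      obtain b where "\<And>a. a \<in> X \<Longrightarrow> a \<sqsubset> b"
        using small_bounded[OF ordLeq_ordLess_trans[OF X small]] by blast
      then show ?thesis
        using K.less_imp_le by blast
    qed
    show "\<exists>y\<in>cyl x b. \<exists>g\<in>UNIV. b \<sqsubseteq> g \<and> cyl y g \<subseteq> - N i" if "i \<in> I" for i x b
      using N[OF that] by (auto simp: nwd_def disjoint_eq_subset_Compl)
  qed auto
  then show "\<exists>y\<in>cyl x a. \<exists>b. a \<sqsubseteq> b \<and> cyl y b \<inter> (\<Union>i\<in>I. N i) = {}"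
    by (metis Compl_UN disjoint_eq_subset_Compl)
qed

subsection \<open>Codes\<close>

definition trunc :: "'k \<Rightarrow> ('k \<Rightarrow> bool) \<Rightarrow> 'k set" where
  "trunc h x = {i. i \<sqsubset> h \<and> x i}"

lemma trunc_eq_cyl: "trunc h x = trunc h y \<Longrightarrow> b \<sqsubseteq> h \<Longrightarrow> x \<in> cyl y b"
  unfolding trunc_def cyl_def using K.less_le_trans by blast

text \<open>A pair \<open>(h, U)\<close> stands for the set \<open>U\<close> of sequences of length \<open>h\<close>, the sequence \<open>x\<restriction>h\<close> being
  represented by the subset \<^term>\<open>trunc h x\<close> of \<open>h\<close>.\<close>

definition hit :: "'k \<times> 'k set set \<Rightarrow> ('k \<Rightarrow> bool) set" where
  "hit c = {x. trunc (fst c) x \<in> snd c}"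

text \<open>The cofinality of \<open>h\<close> exceeds \<open>|a|\<close>; the strict bounds make \<open>h\<close> a limit.\<close>

definition large_cof :: "'k \<Rightarrow> 'k \<Rightarrow> bool" where
  "large_cof a h \<longleftrightarrow> (\<forall>X \<subseteq> underS \<kappa> h. |X| \<le>o |underS \<kappa> a| \<longrightarrow> (\<exists>b. b \<sqsubset> h \<and> (\<forall>i\<in>X. i \<sqsubset> b)))"

text \<open>The bound \<open>g \<sqsubset> h\<close> keeps every length spent on a pair below its
  own \<open>h\<close>, so pairs treated later, whose \<open>h\<close> is no smaller, can still
  dominate it.\<close>

definition dense_below :: "'k \<Rightarrow> ('k \<Rightarrow> bool) set \<Rightarrow> bool" where
  "dense_below h Q \<longleftrightarrow>
     (\<forall>x b. b \<sqsubset> h \<longrightarrow> (\<exists>y\<in>cyl x b. \<exists>g. g \<sqsubset> h \<and> b \<sqsubseteq> g \<and> cyl y g \<subseteq> Q))"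

definition valid :: "'k \<Rightarrow> 'k \<times> 'k set set \<Rightarrow> bool" where
  "valid a c \<longleftrightarrow> a \<sqsubset> fst c \<and> large_cof a (fst c) \<and> dense_below (fst c) (hit c)"

text \<open>Slalom values are sets of ordinals, so pairs must be named by ordinals. Only a map
  covering all pairs is chosen; its existence is part of the proof of
  \<open>range_decode\<close>.\<close>

definition decode :: "'k \<Rightarrow> 'k \<times> 'k set set" where
  "decode = (SOME d. (SIGMA h:UNIV. Pow (Pow (underS \<kappa> h))) \<subseteq> range d)"

text \<open>Since \<open>\<kappa>\<close> is a strong limit, each \<open>h\<close> admits fewer than
  \<open>\<kappa>\<close> sets \<open>U\<close>, so there are at most \<open>\<kappa>\<close> pairs
  in all.\<close>

lemma range_decode: "U \<subseteq> Pow (underS \<kappa> h) \<Longrightarrow> (h, U) \<in> range decode"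
proof -
  let ?C = "SIGMA h:UNIV :: 'k set. Pow (Pow (underS \<kappa> h))"
  have "|Pow (Pow (underS \<kappa> h))| \<le>o |UNIV :: 'k set|" for h
    using card_Pow[OF card_Pow[OF card_underS[of h]]] card_UNIV
    by (meson ordIso_symmetric ordLess_imp_ordLeq ordLess_ordIso_trans)
  then have "|?C| \<le>o |UNIV :: 'k set|"
    using infinite_UNIV by (intro card_of_Sigma_ordLeq_infinite card_of_mono1) auto
  moreover have "?C \<noteq> {}"
    by auto
  ultimately have "\<exists>d :: 'k \<Rightarrow> _. ?C \<subseteq> range d"
    using card_of_ordLeq2 by (metis subset_refl)
  then have "?C \<subseteq> range decode"
    unfolding decode_def by (rule someI_ex)
  moreover assume "U \<subseteq> Pow (underS \<kappa> h)"
  then have "(h, U) \<in> ?C"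
    by (intro SigmaI UNIV_I PowI)
  ultimately show "(h, U) \<in> range decode"
    by (rule subsetD)
qed

section \<open>Cofinality and the existence of valid codes\<close>

lemma finite_card_leq: "finite A \<Longrightarrow> infinite B \<Longrightarrow> |A| \<le>o |B|"
  using card_of_ordLeq_finite card_of_Well_order ordLeq_total by metis

lemma large_cof_exists:
  assumes inf: "infinite (underS \<kappa> a)"
  obtains d where "large_cof a d"
proof -
  obtain B :: "'k set" where B: "|Pow (underS \<kappa> a)| =o |B|"
    using embed_small[OF card_Pow[OF card_underS]] .
  have "|B| <o \<kappa>"
    using B card_Pow[OF card_underS] ordIso_ordLess_trans ordIso_symmetric by blast
  then obtain b where "B \<subseteq> underS \<kappa> b"
    using small_bounded by (metis mem_underS subsetI)
  then have "|underS \<kappa> a| <o |underS \<kappa> b|"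
    using card_of_Pow B card_of_mono1 ordLess_ordIso_trans ordLess_ordLeq_trans by metis
  \<comment> \<open>The least such ordinal is the successor cardinal of \<open>|a|\<close>, hence regular.\<close>
  then obtain d where d: "|underS \<kappa> a| <o |underS \<kappa> d|"
    and least: "\<And>e. e \<sqsubset> d \<Longrightarrow> \<not> |underS \<kappa> a| <o |underS \<kappa> e|"
    using K.exists_least_iff[of "\<lambda>b. |underS \<kappa> a| <o |underS \<kappa> b|"] by blast
  have "large_cof a d"
    unfolding large_cof_def
  proof (intro allI impI, rule ccontr)
    fix X
    assume X: "X \<subseteq> underS \<kappa> d" "|X| \<le>o |underS \<kappa> a|"
      and "\<nexists>b. b \<sqsubset> d \<and> (\<forall>i\<in>X. i \<sqsubset> b)"
    then have cof: "\<exists>i\<in>X. b \<sqsubseteq> i" if "b \<sqsubset> d" for b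
      using that by (metis K.not_less)
    have *: "|underS \<kappa> e| \<le>o |underS \<kappa> a|" if "e \<in> X" for e
      using least[of e] that X(1)
      by (meson card_of_Well_order mem_underS not_ordLess_iff_ordLeq subsetD)
    have "|insert e (underS \<kappa> e)| \<le>o |underS \<kappa> a|" if "e \<in> X" for e
    proof -
      have "|{e} \<union> underS \<kappa> e| \<le>o |underS \<kappa> a|"
        using inf *[OF that] finite_card_leq[OF _ inf, of "{e}"]
        by (intro card_of_Un_ordLeq_infinite_Field)
          (simp_all add: card_of_card_order_on Field_card_of)
      then show ?thesis
        by simp
    qed
    \<comment> \<open>An unbounded \<open>X\<close> would cover \<open>d\<close> by at most
      \<open>|a|\<close> sets of size at most \<open>|a|\<close>. Inserting \<open>e\<close>
      accounts for elements of \<open>X\<close> themselves, as \<open>cof\<close> is not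
      strict.\<close>
    then have "|\<Union>e\<in>X. insert e (underS \<kappa> e)| \<le>o |underS \<kappa> a|"
      using inf X(2) by (intro card_of_UNION_ordLeq_infinite) auto
    moreover have "underS \<kappa> d \<subseteq> (\<Union>e\<in>X. insert e (underS \<kappa> e))"
      using cof K.le_less by fastforce
    ultimately have "|underS \<kappa> d| \<le>o |underS \<kappa> a|"
      using card_of_mono1 ordLeq_transitive by blast
    then show False
      using d not_ordLess_ordLeq by blast
  qed
  then show ?thesis
    using that by blast
qed

text \<open>There are fewer than \<open>\<kappa>\<close> sequences of length \<open>b\<close>, so
  the lengths needed for each of them have a common bound below \<open>\<kappa>\<close>.\<close>

lemma nwd_uniform:
  assumes "nwd N"
  obtains g where "b \<sqsubseteq> g" "\<And>x. \<exists>y\<in>cyl x b. cyl y g \<inter> N = {}"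
proof -
  \<comment> \<open>Sequences of length \<open>b\<close> are indexed by subsets \<open>s\<close> of
    \<open>b\<close>, so that \<open>card_Pow\<close> counts them.\<close>
  have "\<exists>c. b \<sqsubseteq> c \<and> (\<exists>y\<in>cyl (\<lambda>i. i \<in> s) b. cyl y c \<inter> N = {})" for s
    using assms unfolding nwd_def by blast
  then obtain G where G: "\<And>s. b \<sqsubseteq> G s" "\<And>s. \<exists>y\<in>cyl (\<lambda>i. i \<in> s) b. cyl y (G s) \<inter> N = {}"
    by metis
  have "|G ` Pow (underS \<kappa> b)| <o \<kappa>"
    using card_of_image card_Pow[OF card_underS] ordLeq_ordLess_trans by blast
  then obtain g where g: "\<And>s. s \<subseteq> underS \<kappa> b \<Longrightarrow> G s \<sqsubset> g"
    using small_bounded by (metis PowI imageI)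
  show ?thesis
  proof
    show "b \<sqsubseteq> g"
      using G(1)[of "{}"] g[of "{}"] K.le_less_trans K.less_imp_le by blast
    fix x
    let ?s = "trunc b x"
    obtain y where y: "y \<in> cyl (\<lambda>i. i \<in> ?s) b" "cyl y (G ?s) \<inter> N = {}"
      using G(2) by blast
    have "y \<in> cyl x b"
      using y(1) by (auto simp: cyl_def trunc_def)
    moreover have "G ?s \<sqsubseteq> g"
    proof -
      have "?s \<subseteq> underS \<kappa> b"
        by (auto simp: trunc_def)
      then show ?thesis
        using g K.less_imp_le by blast
    qed
    ultimately show "\<exists>y\<in>cyl x b. cyl y g \<inter> N = {}"
      using y(2) cyl_mono by blast
  qed
qed

text \<open>Iterate the uniform length function \<open>G\<close> along \<open>d\<close>, starting
  above \<open>a\<close>, and let \<open>h\<close> be the supremum. Then \<open>h\<close> is closed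
  under extensions missing \<open>N\<close> and inherits its cofinality from
  \<open>d\<close>.\<close>

lemma dense_below_exists:
  assumes inf: "infinite (underS \<kappa> a)" and N: "nwd N"
  obtains h where "a \<sqsubset> h" "large_cof a h"
    "\<And>x b. b \<sqsubset> h \<Longrightarrow> \<exists>y\<in>cyl x b. \<exists>g. g \<sqsubset> h \<and> b \<sqsubseteq> g \<and> cyl y g \<inter> N = {}"
proof -
  have "\<forall>b. \<exists>g. b \<sqsubseteq> g \<and> (\<forall>x. \<exists>y\<in>cyl x b. cyl y g \<inter> N = {})"
    using nwd_uniform[OF N] by metis
  from choice[OF this] obtain G
    where G: "\<And>b. b \<sqsubseteq> G b" "\<And>b x. \<exists>y\<in>cyl x b. cyl y (G b) \<inter> N = {}"
    by blast
  obtain d where d: "large_cof a d"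
    using large_cof_exists[OF inf] .
  have "\<exists>e. \<forall>i. a \<sqsubset> e i \<and> (\<forall>j. (j, i) \<in> {(a, b). a \<sqsubset> b} \<longrightarrow> G (e j) \<sqsubset> e i)"
  proof (rule dependent_wf_choice[OF wf_lt])
    fix e :: "'k \<Rightarrow> 'k" and i
    have "|(G \<circ> e) ` underS \<kappa> i| <o \<kappa>"
      using card_of_image card_underS ordLeq_ordLess_trans by blast
    then obtain c where c: "\<And>j. j \<sqsubset> i \<Longrightarrow> G (e j) \<sqsubset> c"
      using small_bounded by (metis comp_apply imageI mem_underS)
    obtain c' where "a \<sqsubset> c'"
      using ex_gt by blast
    then show "\<exists>r. a \<sqsubset> r \<and> (\<forall>j. (j, i) \<in> {(a, b). a \<sqsubset> b} \<longrightarrow> G (e j) \<sqsubset> r)"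
      using c ex_upper[of c c'] K.less_le_trans by blast
  qed auto
  then obtain e where e: "\<And>i. a \<sqsubset> e i" "\<And>i j. j \<sqsubset> i \<Longrightarrow> G (e j) \<sqsubset> e i"
    by auto
  have "|e ` underS \<kappa> d| <o \<kappa>"
    using card_of_image card_underS ordLeq_ordLess_trans by blast
  then obtain h0 where "\<And>j. j \<sqsubset> d \<Longrightarrow> e j \<sqsubset> h0"
    using small_bounded by (metis imageI mem_underS)
  then obtain h where h: "\<And>j. j \<sqsubset> d \<Longrightarrow> e j \<sqsubset> h"
    \<comment> \<open>Leastness makes the values \<open>e j\<close> cofinal in \<open>h\<close>,
      which pulls subsets of \<open>h\<close> back to subsets of \<open>d\<close>.\<close>
    and least: "\<And>b. b \<sqsubset> h \<Longrightarrow> \<exists>j. j \<sqsubset> d \<and> b \<sqsubseteq> e j"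
    using K.exists_least_iff[of "\<lambda>h. \<forall>j. j \<sqsubset> d \<longrightarrow> e j \<sqsubset> h"] K.not_less by metis
  have cof: "large_cof a h"
    unfolding large_cof_def
  proof (intro allI impI)
    fix X
    assume X: "X \<subseteq> underS \<kappa> h" "|X| \<le>o |underS \<kappa> a|"
    then obtain J where J: "\<And>i. i \<in> X \<Longrightarrow> J i \<sqsubset> d \<and> i \<sqsubseteq> e (J i)"
      using least by (metis mem_underS subsetD)
    then have "J ` X \<subseteq> underS \<kappa> d"
      by auto
    moreover have "|J ` X| \<le>o |underS \<kappa> a|"
      using X(2) card_of_image ordLeq_transitive by blast
    ultimately obtain j where j: "j \<sqsubset> d" "\<And>i. i \<in> X \<Longrightarrow> J i \<sqsubset> j"
      using d unfolding large_cof_def by (metis imageI)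
    have "i \<sqsubset> e j" if "i \<in> X" for i
      using J[OF that] j(2)[OF that] e(2) G(1) K.le_less_trans K.order_trans by meson
    then show "\<exists>b. b \<sqsubset> h \<and> (\<forall>i\<in>X. i \<sqsubset> b)"
      using h[OF j(1)] by blast
  qed
  \<comment> \<open>\<open>large_cof\<close> for the empty set shows that \<open>d\<close> is
    nonzero; for a singleton, below, it shows that \<open>d\<close> is a limit.\<close>
  have "|{} :: 'k set| \<le>o |underS \<kappa> a|"
    by (simp add: card_of_empty)
  then obtain j0 where "j0 \<sqsubset> d"
    using d unfolding large_cof_def by blast
  then have "a \<sqsubset> h"
    using h e(1) K.less_trans by blast
  moreover have "\<exists>y\<in>cyl x b. \<exists>g. g \<sqsubset> h \<and> b \<sqsubseteq> g \<and> cyl y g \<inter> N = {}" if b: "b \<sqsubset> h" for x b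
  proof -
    obtain j where j: "j \<sqsubset> d" "b \<sqsubseteq> e j"
      using least[OF b] by blast
    have "|{j}| \<le>o |underS \<kappa> a|"
      using inf by (intro finite_card_leq) auto
    then obtain j' where j': "j' \<sqsubset> d" "j \<sqsubset> j'"
      using d j(1) unfolding large_cof_def by (metis empty_subsetI insert_subset mem_underS singletonI)
    obtain y where y: "y \<in> cyl x (e j)" "cyl y (G (e j)) \<inter> N = {}"
      using G(2) by blast
    have "y \<in> cyl x b"
      using y(1) cyl_mono[OF j(2)] by blast
    moreover have "G (e j) \<sqsubset> h"
      using e(2)[OF j'(2)] h[OF j'(1)] K.less_trans by blast
    moreover have "b \<sqsubseteq> G (e j)"
      using j(2) G(1) K.order_trans by blast
    ultimately show ?thesis
      using y(2) by blast
  qed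
  ultimately show ?thesis
    using cof that by blast
qed

lemma valid_code_exists:
  assumes inf: "infinite (underS \<kappa> a)" and N: "nwd N"
  obtains k where "valid a (decode k)" "hit (decode k) \<inter> N = {}"
proof -
  obtain h where h: "a \<sqsubset> h" "large_cof a h"
    and dense: "\<And>x b. b \<sqsubset> h \<Longrightarrow> \<exists>y\<in>cyl x b. \<exists>g. g \<sqsubset> h \<and> b \<sqsubseteq> g \<and> cyl y g \<inter> N = {}"
    using dense_below_exists[OF assms] by metis
  \<comment> \<open>Only the truncation of \<open>z\<close> is recorded. This suffices: a point with
    the same truncation agrees with \<open>z\<close> below \<open>g \<sqsubset> h\<close>, hence
    lies in the cone missing \<open>N\<close>.\<close>
  define U where "U = {trunc h z | z g. g \<sqsubset> h \<and> cyl z g \<inter> N = {}}"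
  have "U \<subseteq> Pow (underS \<kappa> h)"
    by (auto simp: U_def trunc_def)
  then obtain k where k: "decode k = (h, U)"
    using range_decode by (metis imageE)
  have sub: "cyl y g \<subseteq> hit (h, U)" if "g \<sqsubset> h" "cyl y g \<inter> N = {}" for y g
  proof
    fix z
    assume "z \<in> cyl y g"
    then have "cyl z g \<inter> N = {}"
      using that(2) cyl_subset by blast
    then show "z \<in> hit (h, U)"
      using that(1) by (auto simp: hit_def U_def)
  qed
  have "dense_below h (hit (h, U))"
    unfolding dense_below_def using dense sub by meson
  then have "valid a (decode k)"
    using h by (simp add: valid_def k)
  moreover have "x \<notin> N" if x: "x \<in> hit (h, U)" for x
  proof -
    obtain z g where z: "trunc h x = trunc h z" "g \<sqsubset> h" "cyl z g \<inter> N = {}"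
      using x unfolding hit_def U_def fst_conv snd_conv by blast
    then have "x \<in> cyl z g"
      using trunc_eq_cyl K.less_imp_le by blast
    then show ?thesis
      using z(3) by blast
  qed
  then have "hit (decode k) \<inter> N = {}"
    by (auto simp: k)
  ultimately show ?thesis
    using that by blast
qed

section \<open>From slaloms to meager sets\<close>

lemma extend_hit_all:
  assumes C: "|C| \<le>o |underS \<kappa> a|" "\<And>c. c \<in> C \<Longrightarrow> valid a (decode c)"
  shows "\<exists>y\<in>cyl x a. \<exists>g. a \<sqsubseteq> g \<and> cyl y g \<subseteq> (\<Inter>c\<in>C. hit (decode c))"
proof (rule extend_into_all[where H = "\<lambda>c. underS \<kappa> (fst (decode c))"])
  let ?L = "{(a, b). a \<sqsubset> b}"
  \<comment> \<open>Order by the length \<open>h\<close>, as \<open>mono\<close> requires; ties are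
    broken by the code itself to make the order total.\<close>
  let ?R = "inv_image (?L <*lex*> ?L) (\<lambda>c. (fst (decode c), c))"
  show "wf ?R"
    by (intro wf_inv_image wf_lex_prod wf_lt)
  show "total_on C ?R"
    by (auto simp: total_on_def)
  show "|C| <o \<kappa>"
    using C(1) card_underS ordLeq_ordLess_trans by blast
  show "underS \<kappa> (fst (decode c)) \<subseteq> underS \<kappa> (fst (decode d))" if "(c, d) \<in> ?R" for c d
  proof -
    have "fst (decode c) \<sqsubseteq> fst (decode d)"
      using that by (auto intro: K.less_imp_le)
    then show ?thesis
      using K.less_le_trans by (metis mem_underS subsetI)
  qed
next
  fix c x b
  assume "c \<in> C" "b \<in> underS \<kappa> (fst (decode c))"
  then show "\<exists>y\<in>cyl x b. \<exists>g\<in>underS \<kappa> (fst (decode c)). b \<sqsubseteq> g \<and> cyl y g \<subseteq> hit (decode c)"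
    using C(2) unfolding valid_def dense_below_def by (metis mem_underS)
next
  fix c X
  assume c: "c \<in> C" and X: "X \<subseteq> underS \<kappa> (fst (decode c))" "|X| \<le>o |C|"
  have "large_cof a (fst (decode c))"
    using C(2)[OF c] by (simp add: valid_def)
  moreover have "|X| \<le>o |underS \<kappa> a|"
    using X(2) C(1) ordLeq_transitive by blast
  ultimately show "\<exists>b\<in>underS \<kappa> (fst (decode c)). \<forall>a\<in>X. a \<sqsubseteq> b"
    using X(1) unfolding large_cof_def by (meson K.less_imp_le mem_underS)
next
  show "a \<in> underS \<kappa> (fst (decode c))" if "c \<in> C" for c
    using C(2)[OF that] by (simp add: valid_def)
qed

text \<open>Slalom values may contain ordinals decoding to pairs that cannot always be met, so only
  valid codes count. Finite \<open>a\<close> are skipped because valid codes are constructed for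
  infinite \<open>a\<close> only.\<close>

definition avoid :: "('k \<rightharpoonup> 'k set) \<Rightarrow> 'k \<Rightarrow> ('k \<Rightarrow> bool) set" where
  "avoid \<phi> b = {x. \<forall>a\<in>dom \<phi>. b \<sqsubseteq> a \<longrightarrow> infinite (underS \<kappa> a) \<longrightarrow>
     (\<exists>c\<in>the (\<phi> a). valid a (decode c) \<and> x \<notin> hit (decode c))}"

lemma infinite_underS: "\<exists>a. \<forall>b. a \<sqsubseteq> b \<longrightarrow> infinite (underS \<kappa> b)"
proof -
  have nat: "|UNIV :: nat set| <o \<kappa>"
    using inaccessible unfolding strongly_inaccessible_def
    by (blast intro: ordIso_ordLess_trans[OF card_of_nat])
  then obtain A :: "'k set" where A: "|UNIV :: nat set| =o |A|"
    using embed_small by blast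
  have "|A| <o \<kappa>"
    using ordIso_ordLess_trans[OF ordIso_symmetric[OF A] nat] .
  then obtain a where a: "\<And>i. i \<in> A \<Longrightarrow> i \<sqsubset> a"
    using small_bounded by blast
  have "infinite A"
    using A infinite_iff_card_of_nat ordIso_imp_ordLeq by blast
  moreover have "A \<subseteq> underS \<kappa> b" if "a \<sqsubseteq> b" for b
    using a that K.less_le_trans by (metis mem_underS subsetI)
  ultimately show ?thesis
    using finite_subset by blast
qed

text \<open>The domain of \<open>\<phi>\<close> is unbounded, so some infinite \<open>a\<close> in
  it lies above \<open>b\<close> and the given length. Extending \<open>x\<close> beyond
  \<open>a\<close> to meet all valid codes in \<open>\<phi> a\<close> leaves
  \<open>avoid \<phi> b\<close>.\<close>

lemma nwd_avoid:
  assumes \<phi>: "\<phi> \<in> partial_slaloms \<kappa>"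
  shows "nwd (avoid \<phi> b)"
  unfolding nwd_def
proof (intro allI)
  fix x b'
  obtain a0 where a0: "\<And>a. a0 \<sqsubseteq> a \<Longrightarrow> infinite (underS \<kappa> a)"
    using infinite_underS by blast
  obtain m where m: "b \<sqsubseteq> m" "b' \<sqsubseteq> m" "a0 \<sqsubseteq> m"
    using ex_upper K.order_trans by metis
  obtain a where a: "a \<in> dom \<phi>" "m \<sqsubseteq> a"
    using unbounded[of "dom \<phi>" m] \<phi> by (auto simp: partial_slaloms_def)
  have le: "b \<sqsubseteq> a" "b' \<sqsubseteq> a" "a0 \<sqsubseteq> a"
    using m a(2) K.order_trans by blast+
  define C where "C = {c \<in> the (\<phi> a). valid a (decode c)}"
  have "|the (\<phi> a)| \<le>o |underS \<kappa> a|"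
    using \<phi> a(1) by (intro ordIso_imp_ordLeq) (simp add: partial_slaloms_def)
  moreover have "|C| \<le>o |the (\<phi> a)|"
    by (rule card_of_mono1) (simp add: C_def)
  ultimately have "|C| \<le>o |underS \<kappa> a|"
    using ordLeq_transitive by blast
  then obtain y g where y: "y \<in> cyl x a" "a \<sqsubseteq> g" "cyl y g \<subseteq> (\<Inter>c\<in>C. hit (decode c))"
    using extend_hit_all[of C a x] unfolding C_def by blast
  have "cyl y g \<inter> avoid \<phi> b = {}"
    using y(3) a(1) le(1) a0[OF le(3)] by (fastforce simp: avoid_def C_def)
  moreover have "y \<in> cyl x b'" "b' \<sqsubseteq> g"
    using y le cyl_mono K.order_trans by blast+
  ultimately show "\<exists>y\<in>cyl x b'. \<exists>g. b' \<sqsubseteq> g \<and> cyl y g \<inter> avoid \<phi> b = {}"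
    by blast
qed

lemma meager_avoid:
  assumes "\<phi> \<in> partial_slaloms \<kappa>"
  shows "(\<Union>b. avoid \<phi> b) \<in> meager_sets \<kappa>"
proof -
  have "|range (avoid \<phi>)| \<le>o \<kappa>"
    using card_of_image card_UNIV ordLeq_ordIso_trans by blast
  moreover have "\<forall>N\<in>range (avoid \<phi>). nowhere_dense_in (cantor_topology \<kappa>) N"
    using nwd_avoid[OF assms] by (auto simp: nowhere_dense_iff)
  ultimately show ?thesis
    unfolding meager_sets_def by blast
qed

lemma meager_enumeration:
  assumes "A \<in> meager_sets \<kappa>"
  obtains N :: "'k \<Rightarrow> _" where "A = (\<Union>i. N i)" "\<And>i. nwd (N i)"
proof -
  obtain \<N> where \<N>: "A = \<Union>\<N>" "|\<N>| \<le>o \<kappa>" "\<And>N. N \<in> \<N> \<Longrightarrow> nwd N"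
    using assms by (auto simp: meager_sets_def nowhere_dense_iff)
  show ?thesis
  proof (cases "\<N> = {}")
    \<comment> \<open>The empty family is not the range of any function on \<open>'k\<close>; the
      constant empty set replaces it.\<close>
    case True
    have "nwd {}"
      unfolding nwd_def using cyl_refl by blast
    then show ?thesis
      using that[of "\<lambda>_. {}"] True \<N>(1) by simp
  next
    case False
    have "|\<N>| \<le>o |UNIV :: 'k set|"
      using ordLeq_ordIso_trans[OF \<N>(2) ordIso_symmetric[OF card_UNIV]] .
    then obtain N :: "'k \<Rightarrow> _" where "range N = \<N>"
      using card_of_ordLeq2[OF False, of "UNIV :: 'k set"] by metis
    then show ?thesis
      using that[of N] \<N> by blast
  qed
qed

text \<open>\<open>f a\<close> codes a set disjoint from all \<open>N i\<close> with
  \<open>i \<sqsubset> a\<close>. If \<open>x \<in> N i\<close>, then for large infinite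
  \<open>a\<close> in the domain of \<open>\<phi>\<close> the code \<open>f a\<close> lies in
  \<open>\<phi> a\<close> and is missed by \<open>x\<close>. As \<open>f\<close> is built from
  \<open>A\<close> alone, it serves all \<open>\<phi>\<close>.\<close>

lemma meager_localized:
  assumes "A \<in> meager_sets \<kappa>"
  shows "\<exists>f. \<forall>\<phi>. localized_by \<kappa> f \<phi> \<longrightarrow> A \<subseteq> (\<Union>b. avoid \<phi> b)"
proof -
  obtain N :: "'k \<Rightarrow> _" where N: "A = (\<Union>i. N i)" "\<And>i. nwd (N i)"
    using meager_enumeration[OF assms] by blast
  let ?P = "\<lambda>a k. valid a (decode k) \<and> hit (decode k) \<inter> (\<Union>i\<in>underS \<kappa> a. N i) = {}"
  have "\<forall>a. \<exists>k. infinite (underS \<kappa> a) \<longrightarrow> ?P a k"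
  proof (intro allI)
    fix a
    show "\<exists>k. infinite (underS \<kappa> a) \<longrightarrow> ?P a k"
    proof (cases "finite (underS \<kappa> a)")
      case False
      obtain k where "valid a (decode k)" "hit (decode k) \<inter> (\<Union>i\<in>underS \<kappa> a. N i) = {}"
        using valid_code_exists[OF False nwd_UNION[OF card_underS[of a] N(2)]] .
      then show ?thesis
        by blast
    qed simp
  qed
  from choice[OF this] obtain f where f: "\<And>a. infinite (underS \<kappa> a) \<Longrightarrow> ?P a (f a)"
    by blast
  have "A \<subseteq> (\<Union>b. avoid \<phi> b)" if \<phi>: "localized_by \<kappa> f \<phi>" for \<phi>
  proof
    fix x
    assume "x \<in> A"
    then obtain i where i: "x \<in> N i"
      using N(1) by blast
    obtain b where b: "\<And>a. a \<in> {a \<in> dom \<phi>. f a \<notin> the (\<phi> a)} \<Longrightarrow> a \<sqsubset> b"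
      using small_bounded \<phi> unfolding localized_by_def by blast
    obtain i' where "i \<sqsubset> i'"
      using ex_gt by blast
    then obtain m where m: "b \<sqsubseteq> m" "i \<sqsubset> m"
      using ex_upper[of b i'] K.less_le_trans by blast
    have "x \<in> avoid \<phi> m"
      unfolding avoid_def
    proof (intro CollectI ballI impI)
      fix a
      assume a: "a \<in> dom \<phi>" "m \<sqsubseteq> a" "infinite (underS \<kappa> a)"
      have "f a \<in> the (\<phi> a)"
        using b[of a] a m(1) K.order_trans K.not_less by blast
      moreover have "i \<sqsubset> a"
        using m(2) a(2) K.less_le_trans by blast
      then have "x \<in> (\<Union>i\<in>underS \<kappa> a. N i)"
        using i by (intro UN_I[of i]) simp_all
      then have "x \<notin> hit (decode (f a))"
        using f[OF a(3)] by blast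
      ultimately show "\<exists>c\<in>the (\<phi> a). valid a (decode c) \<and> x \<notin> hit (decode c)"
        using f[OF a(3)] by blast
    qed
    then show "x \<in> (\<Union>b. avoid \<phi> b)"
      by blast
  qed
  then show ?thesis
    by blast
qed

end

theorem theorem3p31:
  fixes \<kappa> :: "'k rel"
  assumes "card_order \<kappa>" and "strongly_inaccessible \<kappa>"
  shows "\<exists>(\<Phi>m :: ('k \<Rightarrow> bool) set \<Rightarrow> 'k \<Rightarrow> 'k) (\<Phi>p :: ('k \<rightharpoonup> 'k set) \<Rightarrow> ('k \<Rightarrow> bool) set).
           \<Phi>p \<in> partial_slaloms \<kappa> \<rightarrow> meager_sets \<kappa> \<and>
           (\<forall>A\<in>meager_sets \<kappa>. \<forall>\<phi>\<in>partial_slaloms \<kappa>.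
              localized_by \<kappa> (\<Phi>m A) \<phi> \<longrightarrow> A \<subseteq> \<Phi>p \<phi>)"
proof -
  interpret inaccessible_cardinal \<kappa>
    using assms by unfold_locales
  define \<Phi>p where "\<Phi>p \<phi> = (\<Union>b. avoid \<phi> b)" for \<phi>
  have "\<Phi>p \<in> partial_slaloms \<kappa> \<rightarrow> meager_sets \<kappa>"
    using meager_avoid by (simp add: \<Phi>p_def)
  moreover obtain \<Phi>m where
    "\<And>A \<phi>. A \<in> meager_sets \<kappa> \<Longrightarrow> localized_by \<kappa> (\<Phi>m A) \<phi> \<Longrightarrow> A \<subseteq> \<Phi>p \<phi>"
    using meager_localized unfolding \<Phi>p_def by metis
  ultimately show ?thesis
    by blast
qed

end
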